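(* Let $C$ be a nonempty closed convex subset of a real Hilbert space $H$ and let $\mathcal{F}:H\to H$. Suppose that (A4), (A5), (A6), (A7) (listed in the context) hold and that $\mathcal{F}$ is $k$-strongly pseudo-monotone and $L$-Lipschitz continuous on $H$. Then the sequence $\{x_n\}$ generated by Algorithm MDISEM (described in the context) converges strongly to the unique element of $VI(C,\mathcal{F})$.
   Context: Notation. $VI(C,\mathcal{F})=\{x\in C:\langle \mathcal{F}x,y-x\rangle\ge 0\ \text{for all } y\in C\}$. $P_D$ denotes the metric projection of $H$ onto a nonempty closed convex set $D$. $\mathcal{F}$ is $L$-Lipschitz continuous on $H$ if $\|\mathcal{F}x-\mathcal{F}y\|\le L\|x-y\|$ for all $x,y\in H$, where $L>0$. $\mathcal{F}$ is $k$-strongly pseudo-monotone on $H$, with $k>0$, if for all $x,y\in H$, $\langle\mathcal{F}x,y-x\rangle\ge0$ implies $\langle\mathcal{F}y,y-x\rangle\ge k\|y-x\|^2$. (For such Lipschitz $\mathcal{F}$ it is known that $VI(C,\mathcal{F})$ consists of exactly one element.) Assumptions. (A4) $0\le\nu_n\le\nu_{n+1}\le 1$ for all $n\ge1$. (A5) $0\le\xi_n\le\xi_{n+1}\le\xi<\min\left\{\frac{\bar\theta-\sqrt{2\bar\theta}}{\bar\theta},\nu_1\right\}$ for all $n\ge1$, where $\bar\theta\in(2,+\infty)$. (A6) $0<\alpha\le\alpha_n\le\alpha_{n+1}<\frac{1}{1+\bar\theta}$ for all $n\ge1$, with the same $\bar\theta\in(2,+\infty)$. (A7) $\{\delta_n\}\subset[1,+\infty)$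 with $\lim_{n\to\infty}\delta_n=1$; $\{\chi_n\}\subset[1,+\infty)$ with $\sum_{n=1}^\infty(\chi_n-1)<+\infty$; $\{\zeta_n\}\subset[0,+\infty)$ with $\sum_{n=0}^\infty\zeta_n<+\infty$. Algorithm MDISEM. Choose $\mu\in(0,1)$, $\lambda_1>0$, $\sigma\in(0,\frac{2}{\mu})$, $\beta\in(\frac{\sigma}{2},\frac{1}{\mu})$ and $x_0,x_1\in H$. For $n=1,2,\dots$: Step 1. $w_n=x_n+\nu_n(x_n-x_{n-1})$, $y_n=P_C(w_n-\beta\lambda_n\mathcal{F}w_n)$, and $\lambda_{n+1}=\min\left\{\frac{\mu\delta_n\|w_n-y_n\|}{\|\mathcal{F}w_n-\mathcal{F}y_n\|},\chi_n\lambda_n+\zeta_n\right\}$ if $\mathcal{F}w_n\ne\mathcal{F}y_n$, and $\lambda_{n+1}=\chi_n\lambda_n+\zeta_n$ otherwise. If $w_n=y_n$ or $\mathcal{F}y_n=0$, stop. Otherwise: Step 2. $u_n=P_{T_n}(w_n-\sigma\lambda_nd_n\mathcal{F}y_n)$, where $T_n=\{x\in H:\langle w_n-\beta\lambda_n\mathcal{F}w_n-y_n,x-y_n\rangle\le0\}$, $\eta_n=w_n-y_n-\beta\lambda_n(\mathcal{F}w_n-\mathcal{F}y_n)$, $d_n=\frac{\langle w_n-y_n,\eta_n\rangle}{\|\eta_n\|^2}$. Step 3. $v_n=x_n+\xi_n(x_n-x_{n-1})$, $x_{n+1}=(1-\alpha_n)v_n+\alpha_nu_n$; replace $n$ by $n+1$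 and return to Step 1. It is understood that the algorithm does not stop and generates an infinite sequence with all quantities well defined (in particular $\eta_n\ne0$ for every $n$). *)

theory Defs
  imports "HOL-Analysis.Analysis"
begin

definition VI :: "'a::real_inner set \<Rightarrow> ('a \<Rightarrow> 'a) \<Rightarrow> 'a set" where
  "VI C F = {x \<in> C. \<forall>y\<in>C. inner (F x) (y - x) \<ge> 0}"

(* The library's closest_point is restricted to the class heine_borel, which excludes
   infinite-dimensional spaces.  The description below is well defined whenever D is a nonempty
   closed convex subset of a Hilbert space. *)
definition metric_proj :: "'a::real_inner set \<Rightarrow> 'a \<Rightarrow> 'a" where
  "metric_proj D a = (THE x. x \<in> D \<and> (\<forall>y\<in>D. norm (a - x) \<le> norm (a - y)))"

definition strongly_pseudomonotone :: "real \<Rightarrow> ('a::real_inner \<Rightarrow> 'a) \<Rightarrow> bool" where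
  "strongly_pseudomonotone k F \<longleftrightarrow> k > 0 \<and>
     (\<forall>x y. inner (F x) (y - x) \<ge> 0 \<longrightarrow> inner (F y) (y - x) \<ge> k * (norm (y - x))\<^sup>2)"

end

theory Submission
  imports Defs
begin

text \<open>
  Let \<open>p\<close> be the solution of the variational inequality.  Existence of \<open>p\<close> in a Hilbert space of
  arbitrary dimension rests on two elementary facts.  Strong pseudo-monotonicity turns the problem
  into finding a point common to a family of closed balls intersected with \<open>C\<close>; a KKM principle for
  convex values (\<open>kkm_convex\<close>) shows that finitely many of them meet, and a finite intersection
  property for closed convex sets (\<open>closed_convex_fip\<close>) passes to the whole family.  The same
  property provides the metric projection.

  The convergence proof combines three estimates.

  \<^item> A projection step from \<open>w n\<close> to \<open>u n\<close> does not merely avoid increasing the distance to \<open>p\<close>: by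
    strong pseudo-monotonicity it eventually contracts it, \<open>(norm (u n - p))\<^sup>2 \<le> (1 - \<kappa>) * (norm (w n - p))\<^sup>2\<close>
    with a fixed \<open>\<kappa> > 0\<close> (\<open>subgradient_extragradient_contraction\<close>).

  \<^item> This needs step sizes for which \<open>\<beta> * lam n * norm (F (w n) - F (y n)) \<le> c * norm (w n - y n)\<close> with
    \<open>c < 1\<close>.  The adaptive rule guarantees a bound of this kind with \<open>lam (n + 1)\<close> in place of \<open>lam n\<close>.
    The step sizes decrease up to summable errors and stay away from \<open>0\<close>, so they converge to a
    positive limit (\<open>almost_decreasing_convergent\<close>), and the replacement costs a factor tending
    to \<open>1\<close>.

  \<^item> The inertial terms and the relaxation by \<open>\<alpha> n\<close> are handled by a Lyapunov function made of two
    consecutive distances and the increment (\<open>inertial_mann_convergence\<close>).  It decreases at each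
    step by at least a fixed multiple of \<open>(norm (w n - p))\<^sup>2\<close> plus the next squared increment.  Both
    therefore tend to \<open>0\<close>, and \<open>x n\<close> differs from \<open>w n\<close> by at most the increment.
\<close>

section \<open>Intersections of closed convex sets and the metric projection\<close>

text \<open>
  Bounded closed convex subsets of a Hilbert space are weakly compact; this is the form of that
  fact which needs no weak topology.  The minimal squared norm over a finite subintersection is
  monotone in the subfamily and bounded, hence has a supremum \<open>r\<close>.  On subintersections whose
  minimum is close to \<open>r\<close>, the parallelogram law makes all points of squared norm close to \<open>r\<close>
  close to each other, so almost minimal points form a Cauchy sequence.  Adjoining any further
  member of the family moves the almost minimal points only slightly, so the limit belongs to
  every member.
\<close>
lemma closed_convex_fip:
  fixes \<F> :: "'a::{real_inner, complete_space} set set"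
  assumes closed: "\<And>S. S \<in> \<F> \<Longrightarrow> closed S" and convex: "\<And>S. S \<in> \<F> \<Longrightarrow> convex S"
    and B: "B \<in> \<F>" "bounded B"
    and fip: "\<And>J. finite J \<Longrightarrow> J \<subseteq> \<F> \<Longrightarrow> \<Inter>J \<noteq> {}"
  shows "\<Inter>\<F> \<noteq> {}"
proof -
  obtain R where R: "\<And>z. z \<in> B \<Longrightarrow> norm z \<le> R"
    using B(2) unfolding bounded_iff by blast
  define \<J> where "\<J> = {J. finite J \<and> J \<subseteq> \<F> \<and> B \<in> J}"
  define g where "g J = (INF z\<in>\<Inter>J. (norm z)\<^sup>2)" for J :: "'a set set"
  have ne: "\<Inter>J \<noteq> {}" if "J \<in> \<J>" for J
    using fip that unfolding \<J>_def by blast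
  have bdd: "bdd_below ((\<lambda>z. (norm z)\<^sup>2) ` \<Inter>J)" for J :: "'a set set"
    by (rule bdd_belowI[of _ 0]) auto
  have g_le: "g J \<le> (norm z)\<^sup>2" if "z \<in> \<Inter>J" for J z
    unfolding g_def using bdd that by (rule cINF_lower)
  have near: "\<exists>z\<in>\<Inter>J. (norm z)\<^sup>2 < g J + e" if "J \<in> \<J>" "e > 0" for J e
    using cINF_less_iff[OF ne[OF that(1)] bdd, of "g J + e"] that(2) unfolding g_def[symmetric]
    by (simp del: Inter_iff)
  have g_bound: "g J \<le> R\<^sup>2" if J: "J \<in> \<J>" for J
  proof -
    obtain z where z: "z \<in> \<Inter>J" using ne[OF J] by blast
    then have "norm z \<le> R" using J R unfolding \<J>_def by blast
    then show ?thesis using g_le[OF z] power_mono[of "norm z" R 2] by simp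
  qed
  have "{B} \<in> \<J>" using B unfolding \<J>_def by simp
  then have \<J>_ne: "\<J> \<noteq> {}" by blast
  have bddg: "bdd_above (g ` \<J>)" using g_bound by (intro bdd_aboveI[of _ "R\<^sup>2"]) auto
  define r where "r = (SUP J\<in>\<J>. g J)"
  have g_r: "g J \<le> r" if "J \<in> \<J>" for J
    unfolding r_def using that bddg by (rule cSUP_upper)
  have "\<exists>J\<in>\<J>. r - inverse (real (Suc n)) < g J" for n
    using less_cSUP_iff[OF \<J>_ne bddg, of "r - inverse (real (Suc n))"] unfolding r_def by simp
  then obtain J where J: "\<And>n. J n \<in> \<J>" "\<And>n. r - inverse (real (Suc n)) < g (J n)"
    by metis
  \<comment> \<open>The midpoint of two points of \<open>\<Inter>(J n)\<close> cannot be much shorter than the points themselves,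
    so the parallelogram law forces their difference to be short.\<close>
  have close: "(norm (a - b))\<^sup>2 \<le> 8 * inverse (real (Suc n))"
    if "a \<in> \<Inter>(J n)" "b \<in> \<Inter>(J n)" "(norm a)\<^sup>2 \<le> r + inverse (real (Suc n))"
      "(norm b)\<^sup>2 \<le> r + inverse (real (Suc n))" for a b n
  proof -
    have "(1/2) *\<^sub>R a + (1/2) *\<^sub>R b \<in> \<Inter>(J n)"
    proof
      fix S assume S: "S \<in> J n"
      then have "convex S" using J(1)[of n] convex unfolding \<J>_def by blast
      then show "(1/2) *\<^sub>R a + (1/2) *\<^sub>R b \<in> S"
        using that(1,2) S by (intro convexD) auto
    qed
    from g_le[OF this] J(2)[of n]
    have "r - inverse (real (Suc n)) \<le> (norm ((1/2) *\<^sub>R a + (1/2) *\<^sub>R b))\<^sup>2" by linarith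
    moreover have "(norm (a - b))\<^sup>2 + 4 * (norm ((1/2) *\<^sub>R a + (1/2) *\<^sub>R b))\<^sup>2
        = 2 * (norm a)\<^sup>2 + 2 * (norm b)\<^sup>2"
      by (simp add: power2_norm_eq_inner inner_simps inner_commute algebra_simps)
    ultimately show ?thesis using that(3,4) by linarith
  qed
  \<comment> \<open>Accumulating the subfamilies makes the almost minimal points comparable across indices;
    \<open>Z S n\<close> is such a point that also lies in \<open>S\<close>, and \<open>Z B\<close> serves as the reference sequence.\<close>
  define K where "K n = (\<Union>i\<le>n. J i)" for n
  have K: "insert S (K n) \<in> \<J>" if "S \<in> \<F>" for S n
  proof -
    have "finite (J i)" "J i \<subseteq> \<F>" "B \<in> J i" for i using J(1)[of i] unfolding \<J>_def by auto
    then show ?thesis using that unfolding K_def \<J>_def by auto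
  qed
  have ex: "\<exists>z. z \<in> \<Inter>(insert S (K n)) \<and> (norm z)\<^sup>2 < r + inverse (real (Suc n))"
    if S: "S \<in> \<F>" for S n
  proof -
    obtain z where "z \<in> \<Inter>(insert S (K n))" "(norm z)\<^sup>2 < g (insert S (K n)) + inverse (real (Suc n))"
      using near[OF K[OF S], of "inverse (real (Suc n))" n] by auto
    then show ?thesis using g_r[OF K[OF S], of n] by (intro exI[of _ z]) linarith
  qed
  define Z where "Z S n = (SOME z. z \<in> \<Inter>(insert S (K n)) \<and> (norm z)\<^sup>2 < r + inverse (real (Suc n)))"
    for S n
  have Z: "Z S n \<in> \<Inter>(insert S (K n))" "(norm (Z S n))\<^sup>2 < r + inverse (real (Suc n))"
    if "S \<in> \<F>" for S n
    using someI_ex[OF ex[OF that, of n]] unfolding Z_def by blast+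
  have dZ: "(norm (Z S m - Z S' n))\<^sup>2 \<le> 8 * inverse (real (Suc n))"
    if "S \<in> \<F>" "S' \<in> \<F>" "n \<le> m" for S S' m n
  proof (rule close)
    show "Z S m \<in> \<Inter>(J n)" "Z S' n \<in> \<Inter>(J n)"
      using Z(1)[OF that(1), of m] Z(1)[OF that(2), of n] that(3) unfolding K_def by auto
    have "inverse (real (Suc m)) \<le> inverse (real (Suc n))" using that(3) by (simp add: field_simps)
    then show "(norm (Z S m))\<^sup>2 \<le> r + inverse (real (Suc n))"
      using Z(2)[OF that(1), of m] by linarith
    show "(norm (Z S' n))\<^sup>2 \<le> r + inverse (real (Suc n))"
      using Z(2)[OF that(2), of n] by linarith
  qed
  have lim8: "(\<lambda>n. 8 * inverse (real (Suc n))) \<longlonglongrightarrow> 0"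
    by (rule tendsto_mult_right_zero[OF LIMSEQ_inverse_real_of_nat])
  have "Cauchy (Z B)"
  proof (rule metric_CauchyI)
    fix e :: real assume e: "e > 0"
    then have "\<forall>\<^sub>F n in sequentially. 8 * inverse (real (Suc n)) < (e/2)\<^sup>2"
      by (intro order_tendstoD(2)[OF lim8]) simp
    then obtain N where N: "8 * inverse (real (Suc N)) < (e/2)\<^sup>2"
      using eventually_happens'[OF sequentially_bot] by blast
    have near_N: "norm (Z B m - Z B N) < e/2" if "m \<ge> N" for m
    proof (rule power_less_imp_less_base[of _ 2])
      show "(norm (Z B m - Z B N))\<^sup>2 < (e/2)\<^sup>2" using dZ[OF B(1) B(1) that] N by linarith
    qed (use e in simp)
    show "\<exists>M. \<forall>m\<ge>M. \<forall>n\<ge>M. dist (Z B m) (Z B n) < e"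
    proof (intro exI allI impI)
      fix m n assume "N \<le> m" "N \<le> n"
      then show "dist (Z B m) (Z B n) < e"
        using dist_triangle_half_r[of "Z B N" "Z B m" e "Z B n"] near_N[of m] near_N[of n]
        by (simp add: dist_norm norm_minus_commute)
    qed
  qed
  then obtain l where l: "Z B \<longlonglongrightarrow> l" using Cauchy_convergent unfolding convergent_def by blast
  have "l \<in> S" if S: "S \<in> \<F>" for S
  proof -
    have "(\<lambda>n. (norm (Z S n - Z B n))\<^sup>2) \<longlonglongrightarrow> 0"
      using dZ[OF S B(1) order_refl]
      by (intro tendsto_sandwich[OF always_eventually always_eventually tendsto_const lim8]) simp_all
    then have "(\<lambda>n. sqrt ((norm (Z S n - Z B n))\<^sup>2)) \<longlonglongrightarrow> sqrt 0"
      by (rule tendsto_real_sqrt)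
    then have "(\<lambda>n. Z S n - Z B n) \<longlonglongrightarrow> 0" by (simp add: tendsto_norm_zero_iff)
    from tendsto_add[OF this l] have "Z S \<longlonglongrightarrow> l" by simp
    moreover have "Z S n \<in> S" for n using Z(1)[OF S, of n] by simp
    ultimately show ?thesis using closed[OF S] closed_sequentially[of S "Z S" l] by simp
  qed
  then show ?thesis by blast
qed

text \<open>
  The nearest points are exactly the points common to all sets \<open>D \<inter> cball a (norm (a - y))\<close> with
  \<open>y \<in> D\<close>.  In a finite subfamily the centre of the smallest ball lies in all members.
\<close>
lemma nearest_point_exists:
  fixes D :: "'a::{real_inner, complete_space} set"
  assumes D: "D \<noteq> {}" "closed D" "convex D"
  shows "\<exists>x\<in>D. \<forall>y\<in>D. norm (a - x) \<le> norm (a - y)"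
proof -
  define \<F> where "\<F> = (\<lambda>y. D \<inter> cball a (norm (a - y))) ` D"
  obtain y0 where y0: "y0 \<in> D" using D by blast
  have "\<Inter>\<F> \<noteq> {}"
  proof (rule closed_convex_fip)
    show "D \<inter> cball a (norm (a - y0)) \<in> \<F>" using y0 unfolding \<F>_def by blast
    fix J assume J: "finite J" "J \<subseteq> \<F>"
    then obtain Y where Y: "finite Y" "Y \<subseteq> D" "J = (\<lambda>y. D \<inter> cball a (norm (a - y))) ` Y"
      unfolding \<F>_def by (metis finite_subset_image)
    show "\<Inter>J \<noteq> {}"
    proof (cases "Y = {}")
      case False
      then obtain y where "y \<in> Y" "\<And>z. z \<in> Y \<Longrightarrow> norm (a - y) \<le> norm (a - z)"
        using ex_min_if_finite[of "(\<lambda>y. norm (a - y)) ` Y"] Y(1) by (force simp: not_less)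
      then have "y \<in> \<Inter>J" using Y by (auto simp: dist_norm)
      then show ?thesis by blast
    qed (use Y in simp)
  qed (use D in \<open>auto simp: \<F>_def intro!: convex_Int\<close>)
  then obtain x where x: "\<And>y. y \<in> D \<Longrightarrow> x \<in> D \<inter> cball a (norm (a - y))"
    unfolding \<F>_def by blast
  then show ?thesis using y0 by (intro bexI[of _ x]) (auto simp: dist_norm)
qed

lemma metric_proj_nearest:
  fixes D :: "'a::{real_inner, complete_space} set"
  assumes D: "D \<noteq> {}" "closed D" "convex D"
  shows "metric_proj D a \<in> D \<and> (\<forall>y\<in>D. norm (a - metric_proj D a) \<le> norm (a - y))"
proof -
  obtain x where x: "x \<in> D" "\<forall>y\<in>D. norm (a - x) \<le> norm (a - y)"
    using nearest_point_exists[OF D] by blast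
  have "\<exists>!x. x \<in> D \<and> (\<forall>y\<in>D. norm (a - x) \<le> norm (a - y))"
  proof (rule ex1I[of _ x])
    fix z assume z: "z \<in> D \<and> (\<forall>y\<in>D. norm (a - z) \<le> norm (a - y))"
    show "z = x"
      by (rule any_closest_point_unique[OF D(3,2), of _ _ a]) (use x z in \<open>simp_all add: dist_norm\<close>)
  qed (use x in simp)
  from theI'[OF this] show ?thesis unfolding metric_proj_def .
qed

lemma metric_proj_obtuse:
  fixes D :: "'a::{real_inner, complete_space} set"
  assumes "closed D" "convex D" "y \<in> D"
  shows "metric_proj D a \<in> D" "inner (a - metric_proj D a) (y - metric_proj D a) \<le> 0"
proof -
  have P: "metric_proj D a \<in> D" "\<And>z. z \<in> D \<Longrightarrow> norm (a - metric_proj D a) \<le> norm (a - z)"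
    using metric_proj_nearest[of D a] assms by auto
  then show "metric_proj D a \<in> D" by simp
  show "inner (a - metric_proj D a) (y - metric_proj D a) \<le> 0"
    by (rule any_closest_point_dot[of D]) (use assms P in \<open>simp_all add: dist_norm\<close>)
qed

section \<open>Convex covers and the KKM principle for convex values\<close>

text \<open>
  The separating direction is the shortest vector of the compact convex difference set, which
  avoids \<open>0\<close> by disjointness.
\<close>
lemma separate_compact_convex:
  fixes A B :: "'a::real_inner set"
  assumes A: "compact A" "convex A" "A \<noteq> {}" and B: "compact B" "convex B" "B \<noteq> {}"
    and disj: "A \<inter> B = {}"
  shows "\<exists>z c. (\<forall>a\<in>A. c < inner z a) \<and> (\<forall>b\<in>B. inner z b < c)"
proof -
  define M where "M = (\<Union>a\<in>A. \<Union>b\<in>B. {a - b})"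
  have M: "compact M" "convex M" "M \<noteq> {}"
    using A B unfolding M_def by (auto intro: compact_differences' convex_differences)
  have "0 \<notin> M" using disj unfolding M_def by auto
  have "\<exists>z\<in>M. \<forall>m\<in>M. norm z \<le> norm m"
    by (rule continuous_attains_inf[OF M(1,3)]) (intro continuous_intros)
  then obtain z where z: "z \<in> M" "\<And>m. m \<in> M \<Longrightarrow> norm z \<le> norm m" by blast
  have "z \<noteq> 0" using z(1) \<open>0 \<notin> M\<close> by blast
  have sep: "inner z b + (norm z)\<^sup>2 \<le> inner z a" if "a \<in> A" "b \<in> B" for a b
  proof -
    have "a - b \<in> M" using that unfolding M_def by blast
    from any_closest_point_dot[OF M(2) compact_imp_closed[OF M(1)] z(1) this, of 0] z(2)
    show ?thesis by (simp add: inner_simps power2_norm_eq_inner)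
  qed
  have cont: "continuous_on B (inner z)" by (intro continuous_intros)
  obtain b0 where b0: "b0 \<in> B" "\<And>b. b \<in> B \<Longrightarrow> inner z b \<le> inner z b0"
    using continuous_attains_sup[OF B(1,3) cont] by blast
  have pos: "(norm z)\<^sup>2 > 0" using \<open>z \<noteq> 0\<close> by simp
  show ?thesis
  proof (intro exI conjI ballI)
    fix a assume "a \<in> A"
    then show "inner z b0 + (norm z)\<^sup>2 / 2 < inner z a" using sep[of a b0] b0(1) pos by linarith
  next
    fix b assume "b \<in> B"
    then show "inner z b < inner z b0 + (norm z)\<^sup>2 / 2" using b0(2)[of b] pos by linarith
  qed
qed

text \<open>
  The Klee--Berge intersection theorem, by induction on the number of sets.  If the last set
  missed the intersection of the others, a hyperplane would separate the two strictly.  Cut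
  everything with that hyperplane: the last set misses the slice of \<open>U\<close>, so the others cover it, and
  the slice still meets every intersection of all but one of the others, because each such
  intersection is convex and has points of \<open>U\<close> on both sides.  By induction the other sets have a
  common point on the hyperplane, contrary to the separation.
\<close>
lemma convex_cover_intersection:
  fixes S :: "'i \<Rightarrow> 'a::real_inner set"
  assumes "finite I" "I \<noteq> {}"
    and "compact U" "convex U" "U \<subseteq> (\<Union>i\<in>I. S i)"
    and "\<And>i. i \<in> I \<Longrightarrow> closed (S i)" "\<And>i. i \<in> I \<Longrightarrow> convex (S i)"
    and "\<And>i. i \<in> I \<Longrightarrow> \<exists>x\<in>U. \<forall>j\<in>I - {i}. x \<in> S j"
  shows "\<exists>x\<in>U. \<forall>i\<in>I. x \<in> S i"
  using assms
proof (induction I arbitrary: U rule: finite_ne_induct)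
  case (singleton i)
  then obtain x where "x \<in> U" by blast
  then show ?case using singleton.prems(3) by (intro bexI[of _ x]) auto
next
  case (insert n I)
  show ?case
  proof (rule ccontr)
    assume no: "\<not> ?thesis"
    define A where "A = U \<inter> (\<Inter>i\<in>I. S i)"
    define B where "B = U \<inter> S n"
    obtain a where "a \<in> U" "\<forall>j\<in>I. a \<in> S j"
      using insert.prems(6)[of n] insert.hyps(3) by auto
    then have a: "a \<in> A" unfolding A_def by blast
    have B_ne: "B \<noteq> {}"
    proof -
      obtain i where "i \<in> I" using insert.hyps(2) by blast
      then obtain b where "b \<in> U" "b \<in> S n"
        using insert.prems(6)[of i] insert.hyps(3) by auto
      then show ?thesis unfolding B_def by blast
    qed
    have "\<exists>z c. (\<forall>a\<in>A. c < inner z a) \<and> (\<forall>b\<in>B. inner z b < c)"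
    proof (rule separate_compact_convex)
      show "compact A" "compact B" unfolding A_def B_def using insert.prems
        by (auto intro!: compact_Int_closed closed_INT)
      show "convex A" "convex B" unfolding A_def B_def using insert.prems
        by (auto intro!: convex_Int convex_INT)
      show "A \<inter> B = {}" using no unfolding A_def B_def by auto
    qed (use a B_ne in auto)
    then obtain z c where z: "\<And>a. a \<in> A \<Longrightarrow> c < inner z a" "\<And>b. b \<in> B \<Longrightarrow> inner z b < c" by blast
    define H where "H = {x. inner z x = c}"
    have H: "closed H" "convex H" unfolding H_def
      using closed_hyperplane[of z c] convex_hyperplane[of z c] by (simp_all add: inner_commute)
    have "\<exists>x\<in>U \<inter> H. \<forall>i\<in>I. x \<in> S i"
    proof (rule insert.IH)
      show "compact (U \<inter> H)" using insert.prems(1) H(1) by (rule compact_Int_closed)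
      show "convex (U \<inter> H)" using insert.prems(2) H(2) by (rule convex_Int)
      show "U \<inter> H \<subseteq> (\<Union>i\<in>I. S i)"
        using insert.prems(3) z(2) unfolding H_def B_def by fastforce
      fix i assume i: "i \<in> I"
      show "closed (S i)" "convex (S i)" using insert.prems(4,5) i by auto
      obtain b where b: "b \<in> U" "\<And>j. j \<in> insert n I - {i} \<Longrightarrow> b \<in> S j"
        using insert.prems(6)[of i] i by blast
      have "b \<in> S n" using b(2)[of n] i insert.hyps(3) by blast
      then have zb: "inner z b < c" using b(1) z(2) unfolding B_def by blast
      have za: "c < inner z a" using a z(1) by blast
      \<comment> \<open>the parameter at which the segment from \<open>b\<close> to \<open>a\<close> crosses \<open>H\<close>\<close>
      define t where "t = (c - inner z b) / (inner z a - inner z b)"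
      have t: "0 \<le> t" "t \<le> 1" "t * (inner z a - inner z b) = c - inner z b"
        unfolding t_def using za zb by (auto simp: field_simps)
      define x where "x = (1 - t) *\<^sub>R b + t *\<^sub>R a"
      have "x \<in> H" unfolding H_def x_def using t(3) by (simp add: inner_simps algebra_simps)
      moreover have "x \<in> U" unfolding x_def
        using t a b(1) insert.prems(2) unfolding A_def by (intro convexD) auto
      moreover have "x \<in> S j" if j: "j \<in> I - {i}" for j unfolding x_def
        using t a b(2)[of j] j insert.prems(5)[of j] unfolding A_def by (intro convexD) auto
      ultimately show "\<exists>x\<in>U \<inter> H. \<forall>j\<in>I - {i}. x \<in> S j" by blast
    qed
    then show False using z(1) unfolding A_def H_def by force
  qed
qed

text \<open>
  The KKM principle.  For convex values it follows from the intersection theorem for covers: by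
  induction on \<open>Y\<close>, all but one of the sets always have a common point in the hull.
\<close>
lemma kkm_convex:
  fixes G :: "'a::real_inner \<Rightarrow> 'a set"
  assumes "finite Y" "Y \<noteq> {}"
    and "\<And>y. y \<in> Y \<Longrightarrow> closed (G y)" "\<And>y. y \<in> Y \<Longrightarrow> convex (G y)"
    and "\<And>Z. Z \<subseteq> Y \<Longrightarrow> convex hull Z \<subseteq> (\<Union>y\<in>Z. G y)"
  shows "\<exists>x\<in>convex hull Y. \<forall>y\<in>Y. x \<in> G y"
  using assms
proof (induction Y rule: finite_psubset_induct)
  case (psubset Y)
  show ?case
  proof (rule convex_cover_intersection)
    show "compact (convex hull Y)" using psubset.hyps by (rule finite_imp_compact_convex_hull)
    show "convex hull Y \<subseteq> (\<Union>y\<in>Y. G y)" using psubset.prems(4)[of Y] by simp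
    fix y assume y: "y \<in> Y"
    show "\<exists>x\<in>convex hull Y. \<forall>j\<in>Y - {y}. x \<in> G j"
    proof (cases "Y - {y} = {}")
      case True
      then show ?thesis using hull_inc[OF y, of convex] by blast
    next
      case False
      have "\<exists>x\<in>convex hull (Y - {y}). \<forall>j\<in>Y - {y}. x \<in> G j"
      proof (rule psubset.IH)
        show "convex hull Z \<subseteq> (\<Union>y\<in>Z. G y)" if "Z \<subseteq> Y - {y}" for Z
          using that psubset.prems(4)[of Z] by blast
      qed (use y False psubset.prems(2,3) in auto)
      then show ?thesis using hull_mono[of "Y - {y}" Y convex] by blast
    qed
  qed (use psubset.hyps psubset.prems(1-3) in auto)
qed

section \<open>Solvability of the variational inequality\<close>

text \<open>
  A Minty argument.  Let \<open>M y\<close> be the set of \<open>z\<close> that satisfy the inequality which strong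
  pseudo-monotonicity gives at \<open>y\<close>.  Completing the square shows that \<open>M y\<close> is a closed ball, so a
  point common to all \<open>C \<inter> M y\<close> exists as soon as finitely many of them always meet.  That follows
  from the KKM principle: a convex combination \<open>z\<close> of points \<open>y\<close> outside all the \<open>M y\<close> would
  satisfy \<open>inner (F z) (y - z) < 0\<close> for each of them, and the weighted average of these numbers is \<open>0\<close>.
  Letting \<open>y\<close> tend to the common point along segments in \<open>C\<close> yields a solution.
\<close>
lemma VI_exists_unique:
  fixes C :: "'a::{real_inner, complete_space} set"
  assumes C: "C \<noteq> {}" "closed C" "convex C"
    and mono: "strongly_pseudomonotone k F" and cont: "continuous_on UNIV F"
  shows "\<exists>p. VI C F = {p}"
proof -
  have k: "k > 0" and pm: "\<And>x y. inner (F x) (y - x) \<ge> 0 \<Longrightarrow> inner (F y) (y - x) \<ge> k * (norm (y - x))\<^sup>2"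
    using mono unfolding strongly_pseudomonotone_def by auto
  define M where "M y = {z. inner (F y) (y - z) \<ge> k * (norm (y - z))\<^sup>2}" for y
  have M_ball: "M y = cball (y - (1 / (2 * k)) *\<^sub>R F y) (norm (F y) / (2 * k))" for y
  proof -
    have "inner (F y) (y - z) \<ge> k * (norm (y - z))\<^sup>2 \<longleftrightarrow>
        norm (y - (1 / (2 * k)) *\<^sub>R F y - z) \<le> norm (F y) / (2 * k)" for z
    proof -
      define f h c where "f = F y" and "h = y - z" and "c = 1 / (2 * k)"
      have c: "c > 0" unfolding c_def using k by simp
      have "norm (h - c *\<^sub>R f) \<le> c * norm f \<longleftrightarrow> (norm (h - c *\<^sub>R f))\<^sup>2 \<le> (c * norm f)\<^sup>2"
        using c by (subst abs_le_square_iff[symmetric]) (simp add: abs_mult)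
      also have "(norm (h - c *\<^sub>R f))\<^sup>2 = (norm h)\<^sup>2 - 2 * c * inner f h + (c * norm f)\<^sup>2"
        unfolding power_mult_distrib power2_norm_eq_inner
        by (simp add: inner_diff_left inner_diff_right inner_commute power2_eq_square algebra_simps)
      also have "\<dots> \<le> (c * norm f)\<^sup>2 \<longleftrightarrow> k * (norm h)\<^sup>2 \<le> inner f h"
        unfolding c_def using k by (simp add: field_simps)
      finally show ?thesis unfolding f_def h_def c_def by (simp add: algebra_simps)
    qed
    then show ?thesis
      by (intro set_eqI) (simp only: M_def mem_Collect_eq mem_cball dist_norm)
  qed
  have hull: "convex hull Z \<subseteq> (\<Union>y\<in>Z. M y)" if fin: "finite Z" for Z
  proof
    fix z assume "z \<in> convex hull Z"
    then obtain t where t: "\<And>y. y \<in> Z \<Longrightarrow> 0 \<le> t y" "sum t Z = 1" "(\<Sum>y\<in>Z. t y *\<^sub>R y) = z"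
      using convex_hull_finite[OF fin] by blast
    show "z \<in> (\<Union>y\<in>Z. M y)"
    proof (rule ccontr)
      assume no: "z \<notin> (\<Union>y\<in>Z. M y)"
      have neg: "inner (F z) (y - z) < 0" if "y \<in> Z" for y
        using no pm[of z y] that unfolding M_def by force
      obtain y0 where y0: "y0 \<in> Z" "t y0 \<noteq> 0" using t(2) by (metis sum.neutral zero_neq_one)
      have "(\<Sum>y\<in>Z. t y * inner (F z) (y - z)) < (\<Sum>y\<in>Z. 0)"
      proof (rule sum_strict_mono_ex1[OF fin])
        show "\<forall>y\<in>Z. t y * inner (F z) (y - z) \<le> 0"
          using mult_nonneg_nonpos[OF t(1) less_imp_le[OF neg]] by simp
        show "\<exists>y\<in>Z. t y * inner (F z) (y - z) < 0"
          using y0 t(1)[OF y0(1)] neg[OF y0(1)] by (intro bexI[of _ y0] mult_pos_neg) auto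
      qed
      moreover have "(\<Sum>y\<in>Z. t y * inner (F z) (y - z)) = inner (F z) ((\<Sum>y\<in>Z. t y *\<^sub>R y) - sum t Z *\<^sub>R z)"
        by (simp add: inner_simps inner_sum_right sum_subtractf right_diff_distrib sum_distrib_right)
      ultimately show False using t by simp
    qed
  qed
  have "\<Inter>((\<lambda>y. C \<inter> M y) ` C) \<noteq> {}"
  proof -
    obtain y0 where y0: "y0 \<in> C" using C by blast
    show ?thesis
    proof (rule closed_convex_fip)
      show "C \<inter> M y0 \<in> (\<lambda>y. C \<inter> M y) ` C" using y0 by blast
      show "bounded (C \<inter> M y0)" unfolding M_ball by (simp add: bounded_Int)
      fix J assume J: "finite J" "J \<subseteq> (\<lambda>y. C \<inter> M y) ` C"
      then obtain Y where Y: "finite Y" "Y \<subseteq> C" "J = (\<lambda>y. C \<inter> M y) ` Y"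
        by (metis finite_subset_image)
      show "\<Inter>J \<noteq> {}"
      proof (cases "Y = {}")
        case False
        have "\<exists>x\<in>convex hull Y. \<forall>y\<in>Y. x \<in> M y"
        proof (rule kkm_convex[OF Y(1) False])
          show "convex hull Z \<subseteq> (\<Union>y\<in>Z. M y)" if "Z \<subseteq> Y" for Z
            using hull finite_subset[OF that Y(1)] .
        qed (simp_all add: M_ball)
        moreover have "convex hull Y \<subseteq> C" using Y C by (simp add: subset_hull)
        ultimately show ?thesis using Y by blast
      qed (use Y in simp)
    qed (use C in \<open>auto simp: M_ball convex_Int\<close>)
  qed
  then obtain p where p: "p \<in> C" "\<And>y. y \<in> C \<Longrightarrow> p \<in> M y" using C(1) by auto
  have "p \<in> VI C F"
  proof -
    have "inner (F p) (z - p) \<ge> 0" if z: "z \<in> C" for z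
    proof -
      \<comment> \<open>points of the segment from \<open>p\<close> to \<open>z\<close> that approach \<open>p\<close>\<close>
      define h where "h n = p + inverse (real (Suc n)) *\<^sub>R (z - p)" for n
      have pos: "inner (F (h n)) (z - p) \<ge> 0" for n
      proof -
        have "h n = (1 - inverse (real (Suc n))) *\<^sub>R p + inverse (real (Suc n)) *\<^sub>R z"
          unfolding h_def by (simp add: algebra_simps)
        then have "h n \<in> C" using C(3) p(1) z by (auto intro!: convexD simp: field_simps)
        from p(2)[OF this] k have "inner (F (h n)) (h n - p) \<ge> 0"
          unfolding M_def by (smt (verit) mem_Collect_eq mult_nonneg_nonneg zero_le_power2)
        then have "inverse (real (Suc n)) * inner (F (h n)) (z - p) \<ge> 0"
          unfolding h_def by (simp only: inner_scaleR_right add_diff_cancel_left')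
        then show ?thesis by (simp add: zero_le_mult_iff)
      qed
      have "h \<longlonglongrightarrow> p + 0 *\<^sub>R (z - p)" unfolding h_def
        by (intro tendsto_intros LIMSEQ_inverse_real_of_nat)
      then have "(\<lambda>n. F (h n)) \<longlonglongrightarrow> F p"
        using continuous_on_tendsto_compose[OF cont, of h p] by simp
      then have "(\<lambda>n. inner (F (h n)) (z - p)) \<longlonglongrightarrow> inner (F p) (z - p)"
        by (intro tendsto_intros)
      then show ?thesis using pos by (intro LIMSEQ_le_const) auto
    qed
    then show ?thesis using p(1) unfolding VI_def by blast
  qed
  moreover have "q = p" if "q \<in> VI C F" for q
  proof -
    have "inner (F p) (q - p) \<ge> 0" "inner (F q) (p - q) \<ge> 0"
      using that \<open>p \<in> VI C F\<close> unfolding VI_def by auto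
    moreover from this(1) have "inner (F q) (q - p) \<ge> k * (norm (q - p))\<^sup>2" by (rule pm)
    ultimately have "k * (norm (q - p))\<^sup>2 \<le> 0" by (simp add: inner_diff_right)
    then show "q = p" using k by (simp add: mult_le_0_iff)
  qed
  ultimately show ?thesis by blast
qed

section \<open>One subgradient extragradient step\<close>

text \<open>
  The basic estimate of the method.  The half-space \<open>T\<close> contains \<open>C\<close>, hence the solution \<open>p\<close>, so the
  obtuse angle property of \<open>u\<close> can be tested at \<open>p\<close>.  The term \<open>inner (F y) (p - u)\<close> splits at \<open>y\<close>:
  strong pseudo-monotonicity controls \<open>inner (F y) (y - p)\<close>, and \<open>u \<in> T\<close> bounds
  \<open>\<beta> * l * inner (F y) (u - y)\<close> from below by \<open>inner \<eta> (u - y)\<close>.  The choice of \<open>d\<close> turns the latter into a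
  square, and the remaining cross term is absorbed by \<open>(norm (w - u))\<^sup>2\<close>.
\<close>
lemma subgradient_extragradient_step:
  fixes C :: "'a::{real_inner, complete_space} set"
  assumes C: "closed C" "convex C" and mono: "strongly_pseudomonotone k F" and p: "p \<in> VI C F"
    and pos: "0 < l" "0 < \<sigma>" "0 < \<beta>" "0 \<le> d"
    and y: "y = metric_proj C (w - (\<beta> * l) *\<^sub>R F w)"
    and \<eta>: "\<eta> = w - y - (\<beta> * l) *\<^sub>R (F w - F y)" and d: "d * (norm \<eta>)\<^sup>2 = inner (w - y) \<eta>"
    and u: "u = metric_proj {z. inner (w - (\<beta> * l) *\<^sub>R F w - y) (z - y) \<le> 0} (w - (\<sigma> * l * d) *\<^sub>R F y)"
  shows "(norm (u - p))\<^sup>2 \<le> (norm (w - p))\<^sup>2 - (\<sigma> / \<beta>) * (2 - \<sigma> / \<beta>) * (d * norm \<eta>)\<^sup>2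
      - 2 * \<sigma> * l * d * k * (norm (y - p))\<^sup>2"
proof -
  define T where "T = {z. inner (w - (\<beta> * l) *\<^sub>R F w - y) (z - y) \<le> 0}"
  have T: "closed T" "convex T"
  proof -
    have "T = {z. inner (w - (\<beta> * l) *\<^sub>R F w - y) z \<le> inner (w - (\<beta> * l) *\<^sub>R F w - y) y}"
      unfolding T_def by (simp add: inner_diff_right)
    then show "closed T" "convex T" by (simp_all add: closed_halfspace_le convex_halfspace_le)
  qed
  have pC: "p \<in> C" and sol: "\<And>z. z \<in> C \<Longrightarrow> inner (F p) (z - p) \<ge> 0"
    using p unfolding VI_def by auto
  have yC: "y \<in> C" and "inner (w - (\<beta> * l) *\<^sub>R F w - y) (p - y) \<le> 0"
    unfolding y using metric_proj_obtuse[OF C pC] by auto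
  then have pT: "p \<in> T" unfolding T_def by simp
  have uT: "u \<in> T" and obt: "inner (w - (\<sigma> * l * d) *\<^sub>R F y - u) (p - u) \<le> 0"
    unfolding u T_def[symmetric] using metric_proj_obtuse[OF T pT] by auto
  have pm: "inner (F y) (y - p) \<ge> k * (norm (y - p))\<^sup>2"
    using mono sol[OF yC] unfolding strongly_pseudomonotone_def by blast
  have "(norm (u - p))\<^sup>2 = (norm (w - p))\<^sup>2 - (norm (w - u))\<^sup>2 + 2 * inner (w - u) (p - u)"
    unfolding power2_norm_eq_inner by (simp add: inner_diff_left inner_diff_right inner_commute)
  also have "inner (w - u) (p - u) \<le> (\<sigma> * l * d) * inner (F y) (p - u)"
    using obt by (simp add: inner_diff_left)
  finally have 1: "(norm (u - p))\<^sup>2 \<le> (norm (w - p))\<^sup>2 - (norm (w - u))\<^sup>2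
      + 2 * ((\<sigma> * l * d) * inner (F y) (p - u))" by simp
  have "inner (F y) (p - u) \<le> - inner (F y) (u - y) - k * (norm (y - p))\<^sup>2"
    using pm by (simp add: inner_diff_right)
  then have 2: "(\<sigma> * l * d) * inner (F y) (p - u)
      \<le> (\<sigma> * l * d) * (- inner (F y) (u - y) - k * (norm (y - p))\<^sup>2)"
    using pos by (intro mult_left_mono) auto
  define r where "r = \<sigma> / \<beta>"
  have \<sigma>: "\<sigma> = r * \<beta>" and r: "r > 0" unfolding r_def using pos by auto
  have "inner \<eta> (u - y) \<le> \<beta> * l * inner (F y) (u - y)"
    using uT unfolding T_def \<eta> by (simp add: inner_diff_left algebra_simps)
  then have 3: "r * d * inner \<eta> (u - y) \<le> r * d * (\<beta> * l * inner (F y) (u - y))"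
    using pos r by (intro mult_left_mono) auto
  have 4: "d * inner \<eta> (u - y) = (d * norm \<eta>)\<^sup>2 - d * inner \<eta> (w - u)"
  proof -
    have "inner \<eta> (u - y) = inner (w - y) \<eta> - inner \<eta> (w - u)"
      by (simp add: inner_diff_left inner_diff_right inner_commute)
    then show ?thesis unfolding d[symmetric] by (simp add: power2_eq_square algebra_simps)
  qed
  have "0 \<le> (norm (w - u - (r * d) *\<^sub>R \<eta>))\<^sup>2" by simp
  also have "\<dots> = (norm (w - u))\<^sup>2 - 2 * (r * (d * inner \<eta> (w - u))) + r\<^sup>2 * (d * norm \<eta>)\<^sup>2"
    unfolding power_mult_distrib power2_norm_eq_inner
    by (simp add: inner_diff_left inner_diff_right inner_commute power2_eq_square algebra_simps)
  finally have 5: "2 * (r * (d * inner \<eta> (w - u))) \<le> (norm (w - u))\<^sup>2 + r\<^sup>2 * (d * norm \<eta>)\<^sup>2" by simp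
  have 6: "r * d * inner \<eta> (u - y) = r * (d * norm \<eta>)\<^sup>2 - r * (d * inner \<eta> (w - u))"
    using 4 by (simp add: algebra_simps)
  have 7: "(\<sigma> * l * d) * (- inner (F y) (u - y) - k * (norm (y - p))\<^sup>2)
      = - (r * d * (\<beta> * l * inner (F y) (u - y))) - \<sigma> * l * d * k * (norm (y - p))\<^sup>2"
    unfolding \<sigma> by (simp add: algebra_simps)
  have 8: "r * (2 - r) * (d * norm \<eta>)\<^sup>2 = 2 * (r * (d * norm \<eta>)\<^sup>2) - r\<^sup>2 * (d * norm \<eta>)\<^sup>2"
    by (simp add: algebra_simps power2_eq_square)
  show ?thesis unfolding r_def[symmetric] using 1 2 3 5 6 7 8 by linarith
qed

text \<open>
  If the step size is effectively smaller than the reciprocal of a local Lipschitz constant, which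
  is the hypothesis with \<open>c\<close>, then \<open>\<eta>\<close> is comparable to \<open>w - y\<close> and \<open>d\<close> is bounded away from \<open>0\<close>.  The
  two terms gained in the basic estimate then dominate multiples of \<open>(norm (w - y))\<^sup>2\<close> and
  \<open>(norm (y - p))\<^sup>2\<close>, and therefore of \<open>(norm (w - p))\<^sup>2\<close>: the step is a contraction towards \<open>p\<close>.
\<close>
lemma subgradient_extragradient_contraction:
  fixes C :: "'a::{real_inner, complete_space} set"
  assumes C: "closed C" "convex C" and mono: "strongly_pseudomonotone k F" and p: "p \<in> VI C F"
    and pos: "0 < l0" "l0 \<le> l" "0 < \<sigma>" "\<sigma> < 2 * \<beta>"
    and y: "y = metric_proj C (w - (\<beta> * l) *\<^sub>R F w)" and wy: "w \<noteq> y"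
    and c: "0 \<le> c" "c < 1" "\<beta> * l * norm (F w - F y) \<le> c * norm (w - y)"
    and \<eta>: "\<eta> = w - y - (\<beta> * l) *\<^sub>R (F w - F y)" and d: "d = inner (w - y) \<eta> / (norm \<eta>)\<^sup>2"
    and u: "u = metric_proj {z. inner (w - (\<beta> * l) *\<^sub>R F w - y) (z - y) \<le> 0} (w - (\<sigma> * l * d) *\<^sub>R F y)"
    and \<kappa>: "2 * \<kappa> \<le> (\<sigma> / \<beta>) * (2 - \<sigma> / \<beta>) * ((1 - c) / (1 + c))\<^sup>2"
      "2 * \<kappa> \<le> 2 * \<sigma> * l0 * ((1 - c) / (1 + c)\<^sup>2) * k" "0 \<le> \<kappa>"
  shows "(norm (u - p))\<^sup>2 \<le> (1 - \<kappa>) * (norm (w - p))\<^sup>2"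
proof -
  have k: "k > 0" using mono unfolding strongly_pseudomonotone_def by simp
  have l: "l > 0" and \<beta>: "\<beta> > 0" using pos by auto
  define N where "N = norm (w - y)"
  have N: "N > 0" unfolding N_def using wy by simp
  have "inner (w - y) (F w - F y) * (\<beta> * l) \<le> N * norm (F w - F y) * (\<beta> * l)"
    unfolding N_def using l \<beta> norm_cauchy_schwarz by (intro mult_right_mono) auto
  also have "\<dots> = N * (\<beta> * l * norm (F w - F y))" by simp
  also have "\<dots> \<le> N * (c * N)" unfolding N_def by (intro mult_left_mono c(3)) simp
  finally have *: "inner (w - y) (F w - F y) * (\<beta> * l) \<le> N * (c * N)" .
  have in_ge: "inner (w - y) \<eta> \<ge> (1 - c) * N\<^sup>2"
  proof -
    have "inner (w - y) \<eta> = N\<^sup>2 - inner (w - y) (F w - F y) * (\<beta> * l)"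
      unfolding \<eta> N_def power2_norm_eq_inner by (subst inner_diff_right) simp
    then show ?thesis using * by (simp add: algebra_simps power2_eq_square)
  qed
  have "norm \<eta> \<le> N + norm ((\<beta> * l) *\<^sub>R (F w - F y))" unfolding \<eta> N_def by (rule norm_triangle_ineq4)
  also have "norm ((\<beta> * l) *\<^sub>R (F w - F y)) = \<beta> * l * norm (F w - F y)"
    unfolding norm_scaleR using l \<beta> by simp
  finally have E_le: "norm \<eta> \<le> (1 + c) * N" using c(3) unfolding N_def by (simp add: distrib_right)
  have "\<eta> \<noteq> 0" using in_ge N c(2) by (auto simp: zero_less_mult_iff not_le mult_le_0_iff)
  then have E: "norm \<eta> > 0" by simp
  have d_ge: "(1 - c) / (1 + c)\<^sup>2 \<le> d"
  proof -
    have "(1 - c) / (1 + c)\<^sup>2 * (norm \<eta>)\<^sup>2 \<le> (1 - c) / (1 + c)\<^sup>2 * ((1 + c) * N)\<^sup>2"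
      using c E_le by (intro mult_left_mono power_mono) auto
    also have "\<dots> = (1 - c) * N\<^sup>2" using c by (simp add: power_mult_distrib)
    finally show ?thesis unfolding d using in_ge E by (simp add: pos_le_divide_eq)
  qed
  have dE_ge: "(1 - c) / (1 + c) * N \<le> d * norm \<eta>"
  proof -
    have "(1 - c) / (1 + c) * N * norm \<eta> \<le> (1 - c) / (1 + c) * N * ((1 + c) * N)"
      using c N E_le by (intro mult_left_mono) auto
    also have "\<dots> = (1 - c) * N\<^sup>2" using c by (simp add: power2_eq_square)
    finally have "(1 - c) / (1 + c) * N \<le> inner (w - y) \<eta> / norm \<eta>"
      using in_ge E by (simp add: pos_le_divide_eq)
    also have "\<dots> = d * norm \<eta>" unfolding d using E by (simp add: power2_eq_square)
    finally show ?thesis .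
  qed
  have d0: "0 \<le> d" using d_ge c by (smt (verit) divide_nonneg_nonneg zero_le_power2)
  have dn: "d * (norm \<eta>)\<^sup>2 = inner (w - y) \<eta>" unfolding d using E by simp
  define r where "r = \<sigma> / \<beta>"
  have r: "0 < r" "r < 2" unfolding r_def using pos \<beta> by (auto simp: field_simps)
  note step = subgradient_extragradient_step[OF C mono p l pos(3) \<beta> d0 y \<eta> dn u, folded r_def]
  have "2 * \<kappa> * N\<^sup>2 \<le> r * (2 - r) * ((1 - c) / (1 + c))\<^sup>2 * N\<^sup>2"
    using \<kappa>(1) unfolding r_def by (intro mult_right_mono) auto
  also have "\<dots> = r * (2 - r) * ((1 - c) / (1 + c) * N)\<^sup>2" by (simp only: power_mult_distrib mult.assoc)
  also have "\<dots> \<le> r * (2 - r) * (d * norm \<eta>)\<^sup>2"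
    using dE_ge r c N by (intro mult_left_mono power_mono) auto
  finally have A: "2 * \<kappa> * N\<^sup>2 \<le> r * (2 - r) * (d * norm \<eta>)\<^sup>2" .
  have "2 * \<sigma> * l0 * ((1 - c) / (1 + c)\<^sup>2) * k \<le> 2 * \<sigma> * l * d * k"
    using pos d_ge d0 k c by (intro mult_right_mono mult_mono mult_left_mono) auto
  then have "2 * \<kappa> * (norm (y - p))\<^sup>2 \<le> 2 * \<sigma> * l * d * k * (norm (y - p))\<^sup>2"
    using \<kappa>(2) by (intro mult_right_mono) auto
  with A step have S: "(norm (u - p))\<^sup>2 \<le> (norm (w - p))\<^sup>2 - 2 * \<kappa> * N\<^sup>2 - 2 * \<kappa> * (norm (y - p))\<^sup>2"
    by linarith
  have "norm (w - p) \<le> N + norm (y - p)" unfolding N_def using norm_triangle_ineq[of "w - y" "y - p"] by simp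
  then have "(norm (w - p))\<^sup>2 \<le> (N + norm (y - p))\<^sup>2" by (intro power_mono) auto
  also have "\<dots> \<le> 2 * N\<^sup>2 + 2 * (norm (y - p))\<^sup>2"
    using sum_squares_bound[of N "norm (y - p)"] by (simp add: power2_sum)
  finally have "\<kappa> * (norm (w - p))\<^sup>2 \<le> \<kappa> * (2 * N\<^sup>2 + 2 * (norm (y - p))\<^sup>2)"
    using \<kappa>(3) by (intro mult_left_mono)
  then show ?thesis using S by (simp add: algebra_simps)
qed

section \<open>Convergence of the step sizes\<close>

text \<open>
  The multiplicative errors accumulate to a bounded factor, so \<open>a\<close> is bounded.  The total error is
  then additive and summable, and subtracting its partial sums from \<open>a\<close> leaves a decreasing
  sequence that is bounded below.
\<close>
lemma almost_decreasing_convergent: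
  fixes a c z :: "nat \<Rightarrow> real"
  assumes a: "\<And>n. 0 \<le> a n" "\<And>n. a (Suc n) \<le> (1 + c n) * a n + z n"
    and c: "\<And>n. 0 \<le> c n" "summable c" and z: "\<And>n. 0 \<le> z n" "summable z"
  shows "convergent a"
proof -
  have "a n \<le> exp (sum c {..<n}) * (a 0 + sum z {..<n})" for n
  proof (induction n)
    case (Suc n)
    have "a (Suc n) \<le> (1 + c n) * a n + z n" by (rule a(2))
    also have "\<dots> \<le> exp (c n) * (exp (sum c {..<n}) * (a 0 + sum z {..<n})) + z n"
      using Suc a(1)[of n] c(1)[of n] by (intro add_right_mono mult_mono) auto
    also have "exp (c n) * (exp (sum c {..<n}) * (a 0 + sum z {..<n}))
        = exp (sum c {..<Suc n}) * (a 0 + sum z {..<n})"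
      by (simp add: exp_add)
    also have "z n \<le> exp (sum c {..<Suc n}) * z n"
      using z(1)[of n] sum_nonneg[of "{..<Suc n}" c] c(1)
      by (simp add: mult_le_cancel_right1)
    finally show ?case by (simp add: algebra_simps)
  qed simp
  moreover have "exp (sum c {..<n}) * (a 0 + sum z {..<n}) \<le> exp (suminf c) * (a 0 + suminf z)" for n
    using sum_le_suminf[OF c(2), of "{..<n}"] sum_le_suminf[OF z(2), of "{..<n}"] c(1) z(1) a(1)[of 0]
    by (intro mult_mono add_left_mono) (auto intro!: add_nonneg_nonneg sum_nonneg)
  ultimately have M: "a n \<le> exp (suminf c) * (a 0 + suminf z)" for n by (rule order_trans)
  define M where "M = exp (suminf c) * (a 0 + suminf z)"
  define e where "e n = c n * M + z n" for n
  have e: "summable e" unfolding e_def by (intro summable_add summable_mult2 c z)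
  have e0: "0 \<le> e n" for n unfolding e_def
    using c(1)[of n] z(1)[of n] a(1)[of n] M[of n] unfolding M_def[symmetric]
    by (intro add_nonneg_nonneg mult_nonneg_nonneg) auto
  define b where "b n = a n - sum e {..<n}" for n
  have "decseq b"
  proof (rule decseq_SucI)
    fix n
    have "c n * a n \<le> c n * M" using M[of n] c(1)[of n] unfolding M_def by (rule mult_left_mono)
    then show "b (Suc n) \<le> b n" using a(2)[of n] unfolding b_def e_def by (simp add: algebra_simps)
  qed
  moreover have "- suminf e \<le> b n" for n
    using sum_le_suminf[OF e, of "{..<n}"] e0 a(1)[of n] unfolding b_def by auto
  ultimately obtain L where "b \<longlonglongrightarrow> L" using decseq_convergent by blast
  from tendsto_add[OF this summable_LIMSEQ[OF e]] have "a \<longlonglongrightarrow> L + suminf e"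
    unfolding b_def by simp
  then show ?thesis unfolding convergent_def by blast
qed

section \<open>Inertial Mann iterations\<close>

lemma bounded_below_descent_tendsto_zero:
  fixes b e :: "nat \<Rightarrow> real"
  assumes "\<And>n. b (Suc n) \<le> b n - e n" "\<And>n. 0 \<le> e n" "\<And>n. m \<le> b n"
  shows "e \<longlonglongrightarrow> 0"
proof -
  have "sum e {..<n} \<le> b 0 - b n" for n
  proof (induction n)
    case (Suc n)
    then show ?case using assms(1)[of n] by simp
  qed simp
  then have "sum e {..<n} \<le> b 0 - m" for n using assms(3)[of n] by (smt (verit))
  then have "summable e" using assms(2) by (intro summableI_nonneg_bounded)
  then show ?thesis by (rule summable_LIMSEQ_zero)
qed

text \<open>
  Expand \<open>v - p\<close> and \<open>w - p\<close> as extrapolations and \<open>x2 - p\<close> as a convex combination, each by the exact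
  identity for squared norms.  The convexity gap \<open>\<alpha> * (1 - \<alpha>) * (norm (u - v))\<^sup>2\<close> of the
  combination is \<open>(1 - \<alpha>) / \<alpha> * (norm (x2 - v))\<^sup>2\<close>, which bounds the increment \<open>x2 - x1\<close> up to a
  multiple of the previous increment.
\<close>
lemma inertial_mann_step:
  fixes p x0 x1 x2 u v w :: "'a::real_inner"
  assumes w: "w = x1 + \<nu> *\<^sub>R (x1 - x0)" and v: "v = x1 + \<xi> *\<^sub>R (x1 - x0)"
    and x2: "x2 = (1 - \<alpha>) *\<^sub>R v + \<alpha> *\<^sub>R u"
    and \<alpha>: "0 < \<alpha>" "\<alpha> < 1" and \<xi>: "0 \<le> \<xi>"
    and u: "(norm (u - p))\<^sup>2 \<le> (1 - \<kappa>) * (norm (w - p))\<^sup>2"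
  shows "(norm (x2 - p))\<^sup>2 \<le> (1 + ((1 - \<alpha>) * \<xi> + \<alpha> * \<nu>)) * (norm (x1 - p))\<^sup>2
      - ((1 - \<alpha>) * \<xi> + \<alpha> * \<nu>) * (norm (x0 - p))\<^sup>2
      + ((1 - \<alpha>) * \<xi> * (1 + \<xi>) + \<alpha> * \<nu> * (1 + \<nu>) + (1 - \<alpha>) / \<alpha> * \<xi> * (1 - \<xi>)) * (norm (x1 - x0))\<^sup>2
      - (1 - \<alpha>) / \<alpha> * (1 - \<xi>) * (norm (x2 - x1))\<^sup>2 - \<alpha> * \<kappa> * (norm (w - p))\<^sup>2"
proof -
  have extrapolate: "(norm (a + t *\<^sub>R (a - b)))\<^sup>2
      = (1 + t) * (norm a)\<^sup>2 - t * (norm b)\<^sup>2 + t * (1 + t) * (norm (a - b))\<^sup>2" for a b :: 'a and t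
    unfolding power2_norm_eq_inner
    by (simp add: inner_diff_left inner_diff_right inner_add_left inner_add_right inner_commute
        algebra_simps)
  have V: "(norm (v - p))\<^sup>2 = (1 + \<xi>) * (norm (x1 - p))\<^sup>2 - \<xi> * (norm (x0 - p))\<^sup>2
      + \<xi> * (1 + \<xi>) * (norm (x1 - x0))\<^sup>2"
    using extrapolate[of "x1 - p" \<xi> "x0 - p"] unfolding v by (simp add: algebra_simps)
  have W: "(norm (w - p))\<^sup>2 = (1 + \<nu>) * (norm (x1 - p))\<^sup>2 - \<nu> * (norm (x0 - p))\<^sup>2
      + \<nu> * (1 + \<nu>) * (norm (x1 - x0))\<^sup>2"
    using extrapolate[of "x1 - p" \<nu> "x0 - p"] unfolding w by (simp add: algebra_simps)
  define h where "h = (1 - \<alpha>) / \<alpha>"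
  have h: "h \<ge> 0" unfolding h_def using \<alpha> by simp
  have "x2 - v = \<alpha> *\<^sub>R (u - v)" unfolding x2 by (simp add: algebra_simps)
  then have "h * (norm (x2 - v))\<^sup>2 = \<alpha> * (1 - \<alpha>) * (norm (u - v))\<^sup>2"
    unfolding h_def using \<alpha> by (simp add: power_mult_distrib power2_eq_square)
  moreover have "(norm (x2 - p))\<^sup>2 = (1 - \<alpha>) * (norm (v - p))\<^sup>2 + \<alpha> * (norm (u - p))\<^sup>2
      - \<alpha> * (1 - \<alpha>) * (norm (u - v))\<^sup>2"
    unfolding x2 power2_norm_eq_inner
    by (simp add: inner_diff_left inner_diff_right inner_add_left inner_add_right inner_commute
        algebra_simps)
  ultimately have X: "(norm (x2 - p))\<^sup>2 = (1 - \<alpha>) * (norm (v - p))\<^sup>2 + \<alpha> * (norm (u - p))\<^sup>2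
      - h * (norm (x2 - v))\<^sup>2" by simp
  have "(1 - \<xi>) * (norm (x2 - x1))\<^sup>2 - \<xi> * (1 - \<xi>) * (norm (x1 - x0))\<^sup>2 \<le> (norm (x2 - v))\<^sup>2"
  proof -
    define a b where "a = x2 - x1" and "b = x1 - x0"
    have eq: "x2 - v = a - \<xi> *\<^sub>R b" unfolding a_def b_def v by simp
    have "(norm (x2 - v))\<^sup>2 - ((1 - \<xi>) * (norm a)\<^sup>2 - \<xi> * (1 - \<xi>) * (norm b)\<^sup>2) = \<xi> * (norm (a - b))\<^sup>2"
      unfolding eq power2_norm_eq_inner
      by (simp add: inner_diff_left inner_diff_right inner_commute algebra_simps)
    also have "\<dots> \<ge> 0" using \<xi> by simp
    finally show ?thesis unfolding a_def b_def by simp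
  qed
  then have "h * ((1 - \<xi>) * (norm (x2 - x1))\<^sup>2 - \<xi> * (1 - \<xi>) * (norm (x1 - x0))\<^sup>2)
      \<le> h * (norm (x2 - v))\<^sup>2" using h by (rule mult_left_mono)
  moreover have "\<alpha> * (norm (u - p))\<^sup>2 \<le> \<alpha> * ((1 - \<kappa>) * (norm (w - p))\<^sup>2)"
    using u \<alpha> by (intro mult_left_mono) auto
  ultimately have main: "(norm (x2 - p))\<^sup>2 \<le> (1 - \<alpha>) * (norm (v - p))\<^sup>2
      + (\<alpha> * (norm (w - p))\<^sup>2 - \<alpha> * \<kappa> * (norm (w - p))\<^sup>2)
      - (h * (1 - \<xi>) * (norm (x2 - x1))\<^sup>2 - h * \<xi> * (1 - \<xi>) * (norm (x1 - x0))\<^sup>2)"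
    unfolding X by (simp add: algebra_simps)
  have "(1 - \<alpha>) * (norm (v - p))\<^sup>2 + \<alpha> * (norm (w - p))\<^sup>2
      = (1 + ((1 - \<alpha>) * \<xi> + \<alpha> * \<nu>)) * (norm (x1 - p))\<^sup>2
      - ((1 - \<alpha>) * \<xi> + \<alpha> * \<nu>) * (norm (x0 - p))\<^sup>2
      + ((1 - \<alpha>) * \<xi> * (1 + \<xi>) + \<alpha> * \<nu> * (1 + \<nu>)) * (norm (x1 - x0))\<^sup>2"
    unfolding V W by (simp add: algebra_simps)
  with main show ?thesis unfolding h_def[symmetric] by (simp add: algebra_simps)
qed

text \<open>
  The function \<open>\<Psi>\<close> combines the squared distances to \<open>p\<close> at two consecutive iterates with the squared
  increment between them.  The one-step estimate shows that it decreases, because the weights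
  \<open>s n\<close> are nondecreasing and because the increment enters with a smaller coefficient \<open>g (Suc n)\<close>
  than the one with which the preceding step removes it.  The difference is at least
  \<open>\<theta> * (1 - \<xi>')\<^sup>2 - 2\<close>, the quantity that the restriction on \<open>\<xi>'\<close> makes positive: \<open>\<theta>\<close> is a lower
  bound of \<open>(1 - \<alpha> n) / \<alpha> n\<close>, and \<open>2\<close> bounds the part of \<open>g\<close> that comes from the two extrapolations.
  Since the weights stay below some \<open>q < 1\<close>, the distances are bounded and \<open>\<Psi>\<close> is bounded below.
  Hence the loss at each step tends to \<open>0\<close>, and it contains both the increments and, by the
  contraction hypothesis, the distances from \<open>w n\<close> to \<open>p\<close>.
\<close>
lemma inertial_mann_convergence:
  fixes x u v w :: "nat \<Rightarrow> 'a::real_inner" and \<nu> \<xi> \<alpha> :: "nat \<Rightarrow> real"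
  assumes w: "\<And>n. w n = x (Suc n) + \<nu> n *\<^sub>R (x (Suc n) - x n)"
    and v: "\<And>n. v n = x (Suc n) + \<xi> n *\<^sub>R (x (Suc n) - x n)"
    and x: "\<And>n. x (Suc (Suc n)) = (1 - \<alpha> n) *\<^sub>R v n + \<alpha> n *\<^sub>R u n"
    and \<nu>: "\<And>n. 0 \<le> \<nu> n" "\<And>n. \<nu> n \<le> \<nu> (Suc n)" "\<And>n. \<nu> n \<le> 1"
    and \<xi>: "\<And>n. 0 \<le> \<xi> n" "\<And>n. \<xi> n \<le> \<xi> (Suc n)" "\<And>n. \<xi> n \<le> \<xi>'" "\<And>n. \<xi> n \<le> \<nu> n"
    and \<alpha>: "0 < \<alpha>'" "\<And>n. \<alpha>' \<le> \<alpha> n" "\<And>n. \<alpha> n \<le> \<alpha> (Suc n)" "\<And>n. \<alpha> n \<le> 1 / (1 + \<theta>)"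
    and \<theta>: "0 < \<theta>" "\<xi>' < 1" "2 < \<theta> * (1 - \<xi>')\<^sup>2"
    and \<kappa>: "0 < \<kappa>" "\<And>n. (norm (u n - p))\<^sup>2 \<le> (1 - \<kappa>) * (norm (w n - p))\<^sup>2"
  shows "x \<longlonglongrightarrow> p"
proof -
  define G where "G n = (norm (x n - p))\<^sup>2" for n
  define D where "D n = (norm (x (Suc n) - x n))\<^sup>2" for n
  define W where "W n = (norm (w n - p))\<^sup>2" for n
  define s where "s n = (1 - \<alpha> n) * \<xi> n + \<alpha> n * \<nu> n" for n
  define h where "h n = (1 - \<alpha> n) / \<alpha> n" for n
  define g where "g n = (1 - \<alpha> n) * \<xi> n * (1 + \<xi> n) + \<alpha> n * \<nu> n * (1 + \<nu> n) + h n * \<xi> n * (1 - \<xi> n)" for n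
  define \<Psi> where "\<Psi> n = G (Suc n) - s n * G n + g n * D n" for n
  define \<epsilon> where "\<epsilon> = \<theta> * (1 - \<xi>')\<^sup>2 - 2"
  have \<epsilon>: "\<epsilon> > 0" unfolding \<epsilon>_def using \<theta> by simp
  define A where "A = 1 / (1 + \<theta>)"
  have A: "A < 1" unfolding A_def using \<theta> by simp
  have \<alpha>0: "0 < \<alpha> n" and \<alpha>A: "\<alpha> n \<le> A" and \<alpha>1: "\<alpha> n < 1" for n
    using \<alpha>(1) \<alpha>(2)[of n] \<alpha>(4)[of n] A unfolding A_def by auto
  have \<xi>1: "\<xi> n < 1" for n using \<xi>(3)[of n] \<theta>(2) by simp
  have G0: "0 \<le> G n" and D0: "0 \<le> D n" and W0: "0 \<le> W n" for n
    unfolding G_def D_def W_def by auto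
  have h\<theta>: "\<theta> \<le> h n" for n
  proof -
    have "\<alpha> n * (1 + \<theta>) \<le> 1" using \<alpha>(4)[of n] \<theta>(1) by (simp add: field_simps)
    then show ?thesis unfolding h_def using \<alpha>0[of n] by (simp add: field_simps)
  qed
  have h_mono: "h (Suc n) \<le> h n" for n
  proof -
    have "1 / \<alpha> (Suc n) \<le> 1 / \<alpha> n" using \<alpha>(3)[of n] \<alpha>0[of n] by (intro divide_left_mono) auto
    then show ?thesis unfolding h_def using \<alpha>0[of n] \<alpha>0[of "Suc n"] by (simp add: diff_divide_distrib)
  qed
  have s0: "0 \<le> s n" for n unfolding s_def
    using \<alpha>0[of n] \<alpha>1[of n] \<xi>(1)[of n] \<nu>(1)[of n] by (intro add_nonneg_nonneg mult_nonneg_nonneg) auto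
  have s_mono: "s n \<le> s (Suc n)" for n
  proof -
    have "s n = \<xi> n + \<alpha> n * (\<nu> n - \<xi> n)" unfolding s_def by (simp add: algebra_simps)
    also have "\<dots> \<le> \<xi> n + \<alpha> (Suc n) * (\<nu> n - \<xi> n)"
      using \<alpha>(3)[of n] \<xi>(4)[of n] by (intro add_left_mono mult_right_mono) auto
    also have "\<dots> = (1 - \<alpha> (Suc n)) * \<xi> n + \<alpha> (Suc n) * \<nu> n" by (simp add: algebra_simps)
    also have "\<dots> \<le> s (Suc n)" unfolding s_def
      using \<alpha>0[of "Suc n"] \<alpha>1[of "Suc n"] \<xi>(2)[of n] \<nu>(2)[of n]
      by (intro add_mono mult_left_mono) auto
    finally show ?thesis .
  qed
  \<comment> \<open>from \<open>1 - s n = (1 - \<alpha> n) * (1 - \<xi> n) + \<alpha> n * (1 - \<nu> n)\<close>\<close>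
  define q where "q = 1 - (1 - A) * (1 - \<xi>')"
  have q: "q < 1" unfolding q_def using A \<theta>(2) by simp
  have sq: "s n \<le> q" for n
  proof -
    have "(1 - A) * (1 - \<xi>') \<le> (1 - \<alpha> n) * (1 - \<xi> n)"
      using \<alpha>A[of n] A \<xi>(3)[of n] \<theta>(2) \<alpha>1[of n] by (intro mult_mono) auto
    moreover have "0 \<le> \<alpha> n * (1 - \<nu> n)" using \<alpha>0[of n] \<nu>(3)[of n] by simp
    ultimately show ?thesis unfolding q_def s_def by (simp add: algebra_simps)
  qed
  have g0: "0 \<le> g n" for n unfolding g_def
    using \<alpha>0[of n] \<alpha>1[of n] \<xi>(1)[of n] \<nu>(1)[of n] \<xi>1[of n] h\<theta>[of n] \<theta>(1)
    by (intro add_nonneg_nonneg mult_nonneg_nonneg) auto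
  have gap: "\<epsilon> \<le> h n * (1 - \<xi> n) - g (Suc n)" for n
  proof -
    let ?m = "Suc n"
    have "\<xi> ?m * (1 + \<xi> ?m) \<le> 1 * 2" using \<xi>(1)[of ?m] \<xi>1[of ?m] by (intro mult_mono) auto
    then have 1: "(1 - \<alpha> ?m) * (\<xi> ?m * (1 + \<xi> ?m)) \<le> (1 - \<alpha> ?m) * 2"
      using \<alpha>1[of ?m] by (intro mult_left_mono) auto
    have "\<nu> ?m * (1 + \<nu> ?m) \<le> 1 * 2" using \<nu>(1)[of ?m] \<nu>(3)[of ?m] by (intro mult_mono) auto
    then have 2: "\<alpha> ?m * (\<nu> ?m * (1 + \<nu> ?m)) \<le> \<alpha> ?m * 2"
      using \<alpha>0[of ?m] by (intro mult_left_mono) auto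
    have "\<theta> * (1 - \<xi>')\<^sup>2 \<le> h ?m * (1 - \<xi> ?m)\<^sup>2"
      using h\<theta>[of ?m] \<xi>(3)[of ?m] \<theta> by (intro mult_mono power_mono) auto
    also have "\<dots> = h ?m * (1 - \<xi> ?m) - h ?m * \<xi> ?m * (1 - \<xi> ?m)"
      by (simp add: power2_eq_square algebra_simps)
    also have "h ?m * (1 - \<xi> ?m) \<le> h n * (1 - \<xi> n)"
      using h_mono[of n] \<xi>(2)[of n] \<xi>1[of ?m] h\<theta>[of n] \<theta>(1) by (intro mult_mono) auto
    finally show ?thesis using 1 2 unfolding \<epsilon>_def g_def by (simp add: mult.assoc)
  qed
  have descent: "\<Psi> (Suc n) \<le> \<Psi> n - (\<epsilon> * D (Suc n) + \<alpha>' * \<kappa> * W n)" for n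
  proof -
    have "G (Suc (Suc n)) \<le> (1 + s n) * G (Suc n) - s n * G n + g n * D n
        - h n * (1 - \<xi> n) * D (Suc n) - \<alpha> n * \<kappa> * W n"
      unfolding G_def D_def W_def s_def g_def h_def
      by (rule inertial_mann_step[OF w v x \<alpha>0 \<alpha>1 \<xi>(1) \<kappa>(2)])
    moreover have "s n * G (Suc n) \<le> s (Suc n) * G (Suc n)"
      using s_mono G0 by (intro mult_right_mono) auto
    moreover have "\<epsilon> * D (Suc n) \<le> (h n * (1 - \<xi> n) - g (Suc n)) * D (Suc n)"
      using gap D0 by (intro mult_right_mono) auto
    moreover have "\<alpha>' * \<kappa> * W n \<le> \<alpha> n * \<kappa> * W n"
      using \<alpha>(2)[of n] \<kappa>(1) W0[of n] by (intro mult_right_mono) auto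
    ultimately show ?thesis unfolding \<Psi>_def by (simp add: algebra_simps)
  qed
  have loss0: "0 \<le> \<epsilon> * D (Suc n) + \<alpha>' * \<kappa> * W n" for n
    using \<epsilon> D0[of "Suc n"] W0[of n] \<alpha>(1) \<kappa>(1) by simp
  have \<Psi>_le: "\<Psi> n \<le> \<Psi> 0" for n
  proof (induction n)
    case (Suc n)
    then show ?case using descent[of n] loss0[of n] by linarith
  qed simp
  \<comment> \<open>\<open>\<Psi> 0 / (1 - q)\<close> is the fixed point of the recursion \<open>G (Suc n) \<le> q * G n + \<Psi> 0\<close>.\<close>
  define M where "M = max (G 0) (\<Psi> 0 / (1 - q))"
  have G_le: "G n \<le> M" for n
  proof (induction n)
    case (Suc n)
    have "G (Suc n) \<le> s n * G n + \<Psi> 0"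
      using \<Psi>_le[of n] mult_nonneg_nonneg[OF g0[of n] D0[of n]] unfolding \<Psi>_def by linarith
    also have "\<dots> \<le> q * M + (1 - q) * M"
    proof (rule add_mono)
      show "s n * G n \<le> q * M" using sq[of n] Suc s0[of n] G0[of n] by (intro mult_mono) auto
      have "\<Psi> 0 / (1 - q) \<le> M" unfolding M_def by simp
      then show "\<Psi> 0 \<le> (1 - q) * M" using q by (simp add: pos_divide_le_eq mult.commute)
    qed
    also have "\<dots> = M" by (simp add: algebra_simps)
    finally show ?case .
  qed (simp add: M_def)
  have \<Psi>_ge: "- M \<le> \<Psi> n" for n
  proof -
    have "s n * G n \<le> 1 * M" using sq[of n] q G_le[of n] G0[of n] s0[of n] by (intro mult_mono) auto
    then show ?thesis
      using G0[of "Suc n"] mult_nonneg_nonneg[OF g0[of n] D0[of n]] unfolding \<Psi>_def by linarith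
  qed
  have loss: "(\<lambda>n. \<epsilon> * D (Suc n) + \<alpha>' * \<kappa> * W n) \<longlonglongrightarrow> 0"
    by (rule bounded_below_descent_tendsto_zero[where b = \<Psi>, OF descent loss0 \<Psi>_ge])
  have small: "f \<longlonglongrightarrow> 0" if "c > 0" "\<And>n. 0 \<le> f n" "\<And>n. c * f n \<le> \<epsilon> * D (Suc n) + \<alpha>' * \<kappa> * W n"
    for f :: "nat \<Rightarrow> real" and c
  proof -
    have "(\<lambda>n. c * f n) \<longlonglongrightarrow> 0"
      using that by (intro tendsto_sandwich[OF always_eventually always_eventually tendsto_const loss]) auto
    then show ?thesis using that(1) by (simp add: tendsto_mult_left_iff[of c f 0, simplified])
  qed
  have "(\<lambda>n. D (Suc n)) \<longlonglongrightarrow> 0"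
    by (rule small[OF \<epsilon>]) (use D0 W0 \<alpha>(1) \<kappa>(1) in auto)
  then have "D \<longlonglongrightarrow> 0" by (rule LIMSEQ_imp_Suc)
  then have "(\<lambda>n. sqrt (D n)) \<longlonglongrightarrow> sqrt 0" by (rule tendsto_real_sqrt)
  moreover have "W \<longlonglongrightarrow> 0"
    by (rule small[of "\<alpha>' * \<kappa>"]) (use D0 W0 \<alpha>(1) \<kappa>(1) \<epsilon> in auto)
  then have "(\<lambda>n. sqrt (W n)) \<longlonglongrightarrow> sqrt 0" by (rule tendsto_real_sqrt)
  ultimately have lim: "(\<lambda>n. sqrt (W n) + sqrt (D n)) \<longlonglongrightarrow> 0"
    using tendsto_add by fastforce
  have "norm (x (Suc n) - p) \<le> sqrt (W n) + sqrt (D n)" for n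
  proof -
    have "x (Suc n) - p = (w n - p) - \<nu> n *\<^sub>R (x (Suc n) - x n)" unfolding w by simp
    then have "norm (x (Suc n) - p) \<le> norm (w n - p) + norm (\<nu> n *\<^sub>R (x (Suc n) - x n))"
      by (metis norm_triangle_ineq4)
    also have "norm (\<nu> n *\<^sub>R (x (Suc n) - x n)) \<le> norm (x (Suc n) - x n)"
      using \<nu>(1)[of n] \<nu>(3)[of n] by (simp add: mult_left_le_one_le)
    finally show ?thesis unfolding W_def D_def by simp
  qed
  then have "(\<lambda>n. norm (x (Suc n) - p)) \<longlonglongrightarrow> 0"
    by (intro tendsto_sandwich[OF always_eventually always_eventually tendsto_const lim]) auto
  then have "(\<lambda>n. x (Suc n) - p) \<longlonglongrightarrow> 0" by (simp add: tendsto_norm_zero_iff)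
  then have "(\<lambda>n. x (Suc n)) \<longlonglongrightarrow> p" by (simp add: LIM_zero_iff)
  then show ?thesis by (rule LIMSEQ_imp_Suc)
qed

section \<open>Strong convergence of the algorithm\<close>

theorem theorem4p3:
  fixes C :: "'a::{real_inner, complete_space} set"
    and F :: "'a \<Rightarrow> 'a"
    and k L \<theta> \<xi>' \<alpha>' \<mu> \<sigma> \<beta> :: real
    and \<nu> \<xi> \<alpha> \<delta> chi \<zeta> lam d :: "nat \<Rightarrow> real"
    and x w y u v \<eta> :: "nat \<Rightarrow> 'a"
    and T :: "nat \<Rightarrow> 'a set"
  assumes C: "C \<noteq> {}" "closed C" "convex C"
    and F_mono: "strongly_pseudomonotone k F"
    and F_lip: "L > 0" "L-lipschitz_on UNIV F"
    and A4: "\<And>n. n \<ge> 1 \<Longrightarrow> 0 \<le> \<nu> n \<and> \<nu> n \<le> \<nu> (n + 1) \<and> \<nu> (n + 1) \<le> 1"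
    and theta: "\<theta> > 2"
    and A5: "\<And>n. n \<ge> 1 \<Longrightarrow> 0 \<le> \<xi> n \<and> \<xi> n \<le> \<xi> (n + 1) \<and> \<xi> (n + 1) \<le> \<xi>'"
            "\<xi>' < min ((\<theta> - sqrt (2 * \<theta>)) / \<theta>) (\<nu> 1)"
    and A6: "0 < \<alpha>'"
            "\<And>n. n \<ge> 1 \<Longrightarrow> \<alpha>' \<le> \<alpha> n \<and> \<alpha> n \<le> \<alpha> (n + 1) \<and> \<alpha> (n + 1) < 1 / (1 + \<theta>)"
    and A7_delta: "\<And>n. n \<ge> 1 \<Longrightarrow> \<delta> n \<ge> 1" "\<delta> \<longlonglongrightarrow> 1"
    and A7_chi: "\<And>n. n \<ge> 1 \<Longrightarrow> chi n \<ge> 1" "summable (\<lambda>n. chi (n + 1) - 1)"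
    and A7_zeta: "\<And>n. \<zeta> n \<ge> 0" "summable \<zeta>"
    and mu: "\<mu> \<in> {0<..<1}"
    and lam1: "lam 1 > 0"
    and sigma: "\<sigma> \<in> {0<..<2 / \<mu>}"
    and beta: "\<beta> \<in> {\<sigma> / 2<..<1 / \<mu>}"
    and w: "\<And>n. n \<ge> 1 \<Longrightarrow> w n = x n + \<nu> n *\<^sub>R (x n - x (n - 1))"
    and y: "\<And>n. n \<ge> 1 \<Longrightarrow> y n = metric_proj C (w n - (\<beta> * lam n) *\<^sub>R F (w n))"
    and lam: "\<And>n. n \<ge> 1 \<Longrightarrow> lam (n + 1) =
               (if F (w n) \<noteq> F (y n)
                then min (\<mu> * \<delta> n * norm (w n - y n) / norm (F (w n) - F (y n)))
                         (chi n * lam n + \<zeta> n)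
                else chi n * lam n + \<zeta> n)"
    and no_stop: "\<And>n. n \<ge> 1 \<Longrightarrow> w n \<noteq> y n \<and> F (y n) \<noteq> 0"
    and T: "\<And>n. n \<ge> 1 \<Longrightarrow>
               T n = {z. inner (w n - (\<beta> * lam n) *\<^sub>R F (w n) - y n) (z - y n) \<le> 0}"
    and eta: "\<And>n. n \<ge> 1 \<Longrightarrow> \<eta> n = w n - y n - (\<beta> * lam n) *\<^sub>R (F (w n) - F (y n))"
    and eta_nz: "\<And>n. n \<ge> 1 \<Longrightarrow> \<eta> n \<noteq> 0"
    and d: "\<And>n. n \<ge> 1 \<Longrightarrow> d n = inner (w n - y n) (\<eta> n) / (norm (\<eta> n))\<^sup>2"
    and u: "\<And>n. n \<ge> 1 \<Longrightarrow> u n = metric_proj (T n) (w n - (\<sigma> * lam n * d n) *\<^sub>R F (y n))"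
    and v: "\<And>n. n \<ge> 1 \<Longrightarrow> v n = x n + \<xi> n *\<^sub>R (x n - x (n - 1))"
    and x: "\<And>n. n \<ge> 1 \<Longrightarrow> x (n + 1) = (1 - \<alpha> n) *\<^sub>R v n + \<alpha> n *\<^sub>R u n"
  shows "\<exists>p. VI C F = {p} \<and> x \<longlonglongrightarrow> p"
proof -
  obtain p where p: "VI C F = {p}"
    using VI_exists_unique[OF C F_mono lipschitz_on_continuous_on[OF F_lip(2)]] by blast
  then have pV: "p \<in> VI C F" by simp
  have Lip: "norm (F a - F b) \<le> L * norm (a - b)" for a b
    using lipschitz_onD[OF F_lip(2), of a b] by (simp add: dist_norm)
  have k: "k > 0" using F_mono unfolding strongly_pseudomonotone_def by simp
  have \<mu>: "0 < \<mu>" and \<sigma>: "0 < \<sigma>" "\<sigma> < 2 * \<beta>" and \<beta>: "0 < \<beta>" and \<beta>\<mu>: "\<beta> * \<mu> < 1"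
    using mu sigma beta by (auto simp: field_simps)

  \<comment> \<open>Lipschitz continuity bounds the adaptive quotient below by \<open>\<mu> / L\<close>, so the step sizes stay
    away from \<open>0\<close>.\<close>
  define l0 where "l0 = min (lam 1) (\<mu> / L)"
  have l0: "l0 > 0" unfolding l0_def using lam1 \<mu> F_lip(1) by simp
  have lam_ge: "l0 \<le> lam n" if "n \<ge> 1" for n
    using that
  proof (induction n rule: nat_induct_at_least)
    case base
    then show ?case unfolding l0_def by simp
  next
    case (Suc n)
    have "1 * lam n \<le> chi n * lam n"
      using A7_chi(1)[of n] Suc l0 by (intro mult_right_mono) auto
    then have A: "l0 \<le> chi n * lam n + \<zeta> n" using Suc.IH A7_zeta(1)[of n] by simp
    have B: "l0 \<le> \<mu> * \<delta> n * norm (w n - y n) / norm (F (w n) - F (y n))" if "F (w n) \<noteq> F (y n)"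
    proof -
      have "\<mu> / L * norm (F (w n) - F (y n)) \<le> \<mu> / L * (L * norm (w n - y n))"
        using Lip \<mu> F_lip(1) by (intro mult_left_mono) auto
      also have "\<dots> = \<mu> * 1 * norm (w n - y n)" using F_lip(1) by simp
      also have "\<dots> \<le> \<mu> * \<delta> n * norm (w n - y n)"
        using A7_delta(1)[of n] Suc.hyps \<mu> by (intro mult_right_mono mult_left_mono) auto
      finally have "\<mu> / L \<le> \<mu> * \<delta> n * norm (w n - y n) / norm (F (w n) - F (y n))"
        using that by (simp add: pos_le_divide_eq)
      then show ?thesis unfolding l0_def by simp
    qed
    show ?case using lam[OF Suc.hyps] A B by (auto split: if_splits)
  qed
  then have lam_pos: "0 < lam n" if "n \<ge> 1" for n using that l0 by force

  have "convergent (\<lambda>n. lam (Suc n))"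
  proof (rule almost_decreasing_convergent)
    show "0 \<le> lam (Suc n)" for n using lam_pos[of "Suc n"] by simp
    show "lam (Suc (Suc n)) \<le> (1 + (chi (n + 1) - 1)) * lam (Suc n) + \<zeta> (Suc n)" for n
      using lam[of "Suc n"] by (auto split: if_splits)
    show "0 \<le> chi (n + 1) - 1" for n using A7_chi(1)[of "n + 1"] by simp
    show "summable (\<lambda>n. \<zeta> (Suc n))" using A7_zeta(2) by (simp add: summable_Suc_iff)
  qed (use A7_chi A7_zeta in auto)
  then obtain l where l: "(\<lambda>n. lam (Suc n)) \<longlonglongrightarrow> l" unfolding convergent_def by blast
  have "l0 \<le> l" by (rule LIMSEQ_le_const[OF l]) (use lam_ge in auto)
  then have "l \<noteq> 0" using l0 by simp
  \<comment> \<open>The rule for the step size controls \<open>F (w n) - F (y n)\<close> through \<open>lam (Suc n)\<close>, whereas step \<open>n\<close>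
    uses \<open>lam n\<close>.  As the limit is not \<open>0\<close>, the quotient of the two tends to \<open>1\<close>, and the factor
    \<open>\<beta> * \<mu> < 1\<close> leaves room for a \<open>c\<close> strictly between it and \<open>1\<close>.\<close>
  have "(\<lambda>n. \<beta> * (\<mu> * \<delta> n) * (lam n / lam (Suc n))) \<longlonglongrightarrow> \<beta> * (\<mu> * 1) * (l / l)"
    by (intro tendsto_intros A7_delta l LIMSEQ_imp_Suc[OF l] \<open>l \<noteq> 0\<close>)
  then have ratio: "(\<lambda>n. \<beta> * (\<mu> * \<delta> n) * (lam n / lam (Suc n))) \<longlonglongrightarrow> \<beta> * \<mu>"
    using \<open>l \<noteq> 0\<close> by simp
  define c where "c = (1 + \<beta> * \<mu>) / 2"
  have c: "0 \<le> c" "c < 1" "\<beta> * \<mu> < c" unfolding c_def using \<beta> \<mu> \<beta>\<mu> by (simp_all add: add_nonneg_nonneg)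
  obtain N where N: "\<And>n. n \<ge> N \<Longrightarrow> \<beta> * (\<mu> * \<delta> n) * (lam n / lam (Suc n)) < c"
    using order_tendstoD(2)[OF ratio c(3)] unfolding eventually_sequentially by blast
  have effective: "\<beta> * lam n * norm (F (w n) - F (y n)) \<le> c * norm (w n - y n)" if n: "n \<ge> 1" "n \<ge> N" for n
  proof (cases "F (w n) = F (y n)")
    case True
    then show ?thesis using c(1) by simp
  next
    case False
    have "lam (Suc n) \<le> \<mu> * \<delta> n * norm (w n - y n) / norm (F (w n) - F (y n))"
      using lam[OF n(1)] False by simp
    then have le: "lam (Suc n) * norm (F (w n) - F (y n)) \<le> \<mu> * \<delta> n * norm (w n - y n)"
      using False by (simp add: pos_le_divide_eq)
    have pos: "0 < lam n" "0 < lam (Suc n)" using lam_pos[of n] lam_pos[of "Suc n"] n by auto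
    have "\<beta> * lam n * norm (F (w n) - F (y n))
        = \<beta> * (lam n / lam (Suc n)) * (lam (Suc n) * norm (F (w n) - F (y n)))"
      using pos by simp
    also have "\<dots> \<le> \<beta> * (lam n / lam (Suc n)) * (\<mu> * \<delta> n * norm (w n - y n))"
      using le pos \<beta> by (intro mult_left_mono) auto
    also have "\<dots> = \<beta> * (\<mu> * \<delta> n) * (lam n / lam (Suc n)) * norm (w n - y n)" by simp
    also have "\<dots> \<le> c * norm (w n - y n)" using N[OF n(2)] by (intro mult_right_mono) auto
    finally show ?thesis .
  qed

  \<comment> \<open>\<open>K1\<close> and \<open>K2\<close> bound the coefficients of the gains \<open>(norm (w n - y n))\<^sup>2\<close> and
    \<open>(norm (y n - p))\<^sup>2\<close> from below; halving pays for the cross term in \<open>(norm (w n - p))\<^sup>2\<close>.\<close>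
  define K1 K2 where "K1 = (\<sigma> / \<beta>) * (2 - \<sigma> / \<beta>) * ((1 - c) / (1 + c))\<^sup>2"
    and "K2 = 2 * \<sigma> * l0 * ((1 - c) / (1 + c)\<^sup>2) * k"
  define \<kappa> where "\<kappa> = min K1 K2 / 2"
  have "\<sigma> / \<beta> < 2" using \<sigma> \<beta> by (simp add: field_simps)
  then have "K1 > 0" "K2 > 0" unfolding K1_def K2_def
    using \<sigma> \<beta> c l0 k by (auto intro!: mult_pos_pos divide_pos_pos zero_less_power)
  then have \<kappa>: "\<kappa> > 0" "2 * \<kappa> \<le> K1" "2 * \<kappa> \<le> K2" unfolding \<kappa>_def by auto
  have contraction: "(norm (u n - p))\<^sup>2 \<le> (1 - \<kappa>) * (norm (w n - p))\<^sup>2" if n: "n \<ge> 1" "n \<ge> N" for n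
    using subgradient_extragradient_contraction[OF C(2,3) F_mono pV l0 lam_ge[OF n(1)] \<sigma> y[OF n(1)] _
        c(1,2) effective[OF n] eta[OF n(1)] d[OF n(1)] u[OF n(1), unfolded T[OF n(1)]]
        \<kappa>(2,3)[unfolded K1_def K2_def] less_imp_le[OF \<kappa>(1)]] no_stop[OF n(1)]
    by blast

  have \<theta>: "\<xi>' < 1" "2 < \<theta> * (1 - \<xi>')\<^sup>2"
  proof -
    have r: "sqrt (2 * \<theta>) < \<theta> * (1 - \<xi>')" using A5(2) theta by (simp add: field_simps)
    have "0 \<le> sqrt (2 * \<theta>)" using theta by simp
    with r have "0 < \<theta> * (1 - \<xi>')" by linarith
    then show "\<xi>' < 1" using theta by (simp add: zero_less_mult_iff)
    have "(sqrt (2 * \<theta>))\<^sup>2 < (\<theta> * (1 - \<xi>'))\<^sup>2" using r theta by (intro power_strict_mono) auto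
    then have "\<theta> * 2 < \<theta> * (\<theta> * (1 - \<xi>')\<^sup>2)" using theta by (simp add: power2_eq_square algebra_simps)
    then show "2 < \<theta> * (1 - \<xi>')\<^sup>2" using theta by (simp only: mult_less_cancel_left_pos)
  qed
  have \<nu>1: "\<nu> 1 \<le> \<nu> n" if "n \<ge> 1" for n
    using that
  proof (induction n rule: nat_induct_at_least)
    case (Suc n)
    then show ?case using A4[OF Suc.hyps] by simp
  qed simp
  \<comment> \<open>The contraction holds only from \<open>N\<close> on.  The tail of the sequence is again an inertial Mann
    iteration; its parameters are shifted by one more because \<open>\<nu> n\<close> multiplies \<open>x n - x (n - 1)\<close>.\<close>
  have "(\<lambda>n. x (n + N)) \<longlonglongrightarrow> p"
  proof (rule inertial_mann_convergence)
    fix n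
    let ?m = "n + N + 1"
    have m: "?m \<ge> 1" "?m \<ge> N" by auto
    show "w ?m = x (Suc n + N) + \<nu> ?m *\<^sub>R (x (Suc n + N) - x (n + N))" using w[OF m(1)] by simp
    show "v ?m = x (Suc n + N) + \<xi> ?m *\<^sub>R (x (Suc n + N) - x (n + N))" using v[OF m(1)] by simp
    show "x (Suc (Suc n) + N) = (1 - \<alpha> ?m) *\<^sub>R v ?m + \<alpha> ?m *\<^sub>R u ?m" using x[OF m(1)] by simp
    show "0 \<le> \<nu> ?m" "\<nu> ?m \<le> \<nu> (Suc n + N + 1)" "\<nu> ?m \<le> 1" using A4[OF m(1)] by auto
    show "0 \<le> \<xi> ?m" "\<xi> ?m \<le> \<xi> (Suc n + N + 1)" "\<xi> ?m \<le> \<xi>'" using A5(1)[OF m(1)] by auto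
    then show "\<xi> ?m \<le> \<nu> ?m" using A5(2) \<nu>1[OF m(1)] by auto
    show "\<alpha>' \<le> \<alpha> ?m" "\<alpha> ?m \<le> \<alpha> (Suc n + N + 1)" "\<alpha> ?m \<le> 1 / (1 + \<theta>)" using A6(2)[OF m(1)] by auto
    show "(norm (u ?m - p))\<^sup>2 \<le> (1 - \<kappa>) * (norm (w ?m - p))\<^sup>2" by (rule contraction[OF m])
  qed (use A6(1) theta \<theta> \<kappa> in auto)
  then have "x \<longlonglongrightarrow> p" by (rule LIMSEQ_offset)
  then show ?thesis using p by blast
qed

end
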